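(* Let $G$ be a connected $d$-regular graph on $n$ vertices containing exactly one sink $s$, and let $\sigma$ be a configuration with $N$ chips in total on the non-sink vertices. Then the following greedy simulation algorithm terminates after $O(n^3\log(nN))$ iterations: while some non-sink vertex is full, choose a non-sink vertex $u$ maximizing $\lfloor\sigma_u/\deg(u)\rfloor$, let $k=\lfloor\sigma_u/\deg(u)\rfloor$, set $\sigma_u\leftarrow\sigma_u-k\deg(u)$ and add $k$ chips to every non-sink neighbor of $u$ (one iteration = one execution of this loop body).
   Context: Sandpile with a sink: $\sigma\in\mathbb{N}^{V(G)}$ gives chip counts. The sink $s$ never fires and chips sent to it are discarded. A non-sink vertex $v$ is full if $\sigma_v\ge\deg(v)$ (degree counts all neighbors, including $s$); firing $v$ decreases $\sigma_v$ by $\deg(v)$ and adds one chip to each neighbor. A configuration is terminal if no non-sink vertex is full. *)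

theory Defs
  imports Complex_Main "Graph_Theory.Digraph" "Graph_Theory.Digraph_Component"
begin

text \<open>
  A finite simple undirected graph is an instance of the locale \<^locale>\<open>graph\<close>: a finite, symmetric,
  loop-free digraph without parallel arcs. Each edge is a pair of opposite arcs, so the degree of
  \<open>v\<close> (counting all neighbours, the sink included) is \<open>out_degree G v\<close>.
\<close>

definition regular_graph :: "('a, 'b) pre_digraph \<Rightarrow> nat \<Rightarrow> bool" where
  "regular_graph G d \<longleftrightarrow> (\<forall>v\<in>verts G. out_degree G v = d)"

text \<open>
  A configuration is a function \<open>\<sigma> :: 'a \<Rightarrow> nat\<close>; its values at the sink and outside \<open>verts G\<close>
  play no role below.
\<close>

definition nonsink_chips :: "('a, 'b) pre_digraph \<Rightarrow> 'a \<Rightarrow> ('a \<Rightarrow> nat) \<Rightarrow> nat" where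
  "nonsink_chips G s \<sigma> = (\<Sum>v\<in>verts G - {s}. \<sigma> v)"

definition full :: "('a, 'b) pre_digraph \<Rightarrow> 'a \<Rightarrow> ('a \<Rightarrow> nat) \<Rightarrow> 'a \<Rightarrow> bool" where
  "full G s \<sigma> v \<longleftrightarrow> v \<in> verts G - {s} \<and> \<sigma> v \<ge> out_degree G v"

definition terminal :: "('a, 'b) pre_digraph \<Rightarrow> 'a \<Rightarrow> ('a \<Rightarrow> nat) \<Rightarrow> bool" where
  "terminal G s \<sigma> \<longleftrightarrow> (\<forall>v. \<not> full G s \<sigma> v)"

definition greedy_choice :: "('a, 'b) pre_digraph \<Rightarrow> 'a \<Rightarrow> ('a \<Rightarrow> nat) \<Rightarrow> 'a \<Rightarrow> bool" where
  "greedy_choice G s \<sigma> u \<longleftrightarrow> u \<in> verts G - {s} \<and>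
     (\<forall>v\<in>verts G - {s}. \<sigma> v div out_degree G v \<le> \<sigma> u div out_degree G u)"

text \<open>
  Firing \<open>u\<close> a total of \<open>k\<close> times, discarding the chips sent to the sink. It is only used with
  \<open>k * out_degree G u \<le> \<sigma> u\<close>, so the subtraction on \<^typ>\<open>nat\<close> does not truncate.
\<close>

definition fire_times :: "('a, 'b) pre_digraph \<Rightarrow> 'a \<Rightarrow> 'a \<Rightarrow> nat \<Rightarrow> ('a \<Rightarrow> nat) \<Rightarrow> ('a \<Rightarrow> nat)" where
  "fire_times G s u k \<sigma> = (\<lambda>v.
     if v = u then \<sigma> u - k * out_degree G u
     else if v \<noteq> s \<and> u \<rightarrow>\<^bsub>G\<^esub> v then \<sigma> v + k
     else \<sigma> v)"

text \<open>
  One iteration of the loop. This is a relation because the greedy choice need not be unique; a run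
  of \<open>T\<close> iterations, with ties broken arbitrarily, is \<open>greedy_step G s ^^ T\<close>.
\<close>

definition greedy_step :: "('a, 'b) pre_digraph \<Rightarrow> 'a \<Rightarrow> ('a \<Rightarrow> nat) \<Rightarrow> ('a \<Rightarrow> nat) \<Rightarrow> bool" where
  "greedy_step G s \<sigma> \<sigma>' \<longleftrightarrow> \<not> terminal G s \<sigma> \<and>
     (\<exists>u. greedy_choice G s \<sigma> u \<and> \<sigma>' = fire_times G s u (\<sigma> u div out_degree G u) \<sigma>)"

end

theory Submission
  imports Defs
begin

text \<open>
  Let \<open>h v\<close> be the expected hitting time of the sink for the simple random walk started at \<open>v\<close>,
  and use the potential \<open>\<Phi> \<sigma> = (\<Sum>v. \<sigma> v * h v)\<close>. Since \<open>d * h v\<close> exceeds the sum of \<open>h\<close> over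
  the neighbours of \<open>v\<close> by exactly \<open>d\<close>, firing a vertex \<open>k\<close> times lowers \<open>\<Phi>\<close> by exactly \<open>k * d\<close>.
  If the maximal quotient is \<open>k\<close>, then there are at most \<open>2 * k * d * n\<close> chips, so a bound
  \<open>h \<le> 6 * n\<^sup>2\<close> shows that an iteration lowers \<open>\<Phi>\<close> by a factor of at least \<open>1 - 1 / (12 * n ^ 3)\<close>.

  The bound on \<open>h\<close> comes from level sets: summing the equation for \<open>h\<close> over a superlevel set,
  the contributions of inner edges cancel, so the total drop of \<open>h\<close> over the edges leaving the set
  is at most \<open>d * n\<close>. Thus \<open>h\<close> changes by at most \<open>d * n\<close> along an edge, and whenever the level
  rises by \<open>3 * d * n\<close>, a vertex in the middle third contributes all its \<open>d\<close> neighbours to the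
  sublevel set. This can happen at most \<open>n / d\<close> times.
\<close>

section \<open>Neighbourhoods and cuts in a connected regular graph\<close>

locale regular_sink_graph = graph G for G :: "('a, 'b) pre_digraph" +
  fixes d :: nat and s :: 'a
  assumes conn: "connected G"
    and reg: "regular_graph G d"
    and d_pos: "0 < d"
    and sink: "s \<in> verts G"
begin

definition nbrs :: "'a \<Rightarrow> 'a set" where
  "nbrs v = {w. v \<rightarrow>\<^bsub>G\<^esub> w}"

abbreviation n :: nat where
  "n \<equiv> card (verts G)"

lemma nbrs_subset: "nbrs v \<subseteq> verts G"
  by (auto simp: nbrs_def adj_in_verts)

lemma finite_nbrs [simp]: "finite (nbrs v)"
  using finite_subset[OF nbrs_subset] by simp

lemma nbrs_sym: "w \<in> nbrs v \<longleftrightarrow> v \<in> nbrs w"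
  by (auto simp: nbrs_def graph_symmetric)

lemma not_in_nbrs_self [simp]: "v \<notin> nbrs v"
  using adj_not_same by (auto simp: nbrs_def)

lemma out_degree_eq: "v \<in> verts G \<Longrightarrow> out_degree G v = d"
  using reg by (simp add: regular_graph_def)

lemma card_nbrs:
  assumes "v \<in> verts G"
  shows "card (nbrs v) = d"
proof -
  have "nbrs v = head G ` out_arcs G v"
    by (auto simp: nbrs_def arcs_ends_conv)
  moreover have "inj_on (head G) (out_arcs G v)"
    by (auto intro!: inj_onI no_multi_arcs simp: arc_to_ends_def)
  ultimately show ?thesis
    using out_degree_eq[OF assms] by (simp add: card_image out_degree_def)
qed

lemma n_pos: "0 < n"
  using sink by (auto simp: card_gt_0_iff)

text \<open>Follow a path from \<open>x\<close> to \<open>y\<close>: it has to leave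
  \<open>S\<close> somewhere.\<close>

lemma cut_arc:
  assumes "S \<subseteq> verts G" "x \<in> S" "y \<in> verts G" "y \<notin> S"
  obtains v w where "v \<in> S" "w \<in> verts G - S" "w \<in> nbrs v"
proof -
  have "x \<rightarrow>\<^sup>*\<^bsub>G\<^esub> y"
    using conn assms
    by (auto simp: connected_def strongly_connected_def reachable_mk_symmetric_eq[OF sym_arcs])
  then have "y \<in> S \<or> (\<exists>v\<in>S. \<exists>w\<in>verts G - S. w \<in> nbrs v)"
  proof (induction rule: reachable_induct)
    case (step a b)
    then show ?case
      using adj_in_verts(2)[of a b] unfolding nbrs_def by blast
  qed (use assms in simp)
  then show thesis
    using assms that by blast
qed

section \<open>Quadratic bound on subsolutions through level sets\<close>

definition subsolution :: "('a \<Rightarrow> real) \<Rightarrow> bool" where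
  "subsolution g \<longleftrightarrow> g s = 0 \<and> (\<forall>v\<in>verts G. 0 \<le> g v) \<and>
     (\<forall>v\<in>verts G - {s}. (\<Sum>w\<in>nbrs v. g v - g w) \<le> d)"

lemma flux_eq_boundary_flux:
  fixes g :: "'a \<Rightarrow> real"
  assumes "S \<subseteq> verts G"
  shows "(\<Sum>v\<in>S. \<Sum>w\<in>nbrs v. g v - g w) = (\<Sum>v\<in>S. \<Sum>w\<in>nbrs v - S. g v - g w)"
proof -
  have fin: "finite S"
    using assms finite_verts by (rule finite_subset)
  \<comment> \<open>\<open>?I\<close> collects the edges inside \<open>S\<close>, each once from
    either end with opposite signs, so swapping the sums negates it.\<close>
  let ?I = "\<Sum>v\<in>S. \<Sum>w | w \<in> S \<and> w \<in> nbrs v. g v - g w"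
  have "?I = (\<Sum>w\<in>S. \<Sum>v | v \<in> S \<and> w \<in> nbrs v. g v - g w)"
    by (rule sum.swap_restrict[OF fin fin])
  also have "\<dots> = (\<Sum>w\<in>S. \<Sum>v | v \<in> S \<and> v \<in> nbrs w. - (g w - g v))"
    by (simp add: nbrs_sym)
  also have "\<dots> = - ?I"
    by (simp only: sum_negf)
  finally have "?I = 0"
    by simp
  moreover have "(\<Sum>w\<in>nbrs v. g v - g w) =
      (\<Sum>w | w \<in> S \<and> w \<in> nbrs v. g v - g w) + (\<Sum>w\<in>nbrs v - S. g v - g w)" for v
    by (subst sum.union_disjoint[symmetric]) (auto intro!: sum.cong simp: fin)
  ultimately show ?thesis
    by (simp add: sum.distrib)
qed

text \<open>No edge leaving a superlevel set goes uphill, so a single one carries at most the total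
  outflow. Cutting strictly above \<open>g w\<close> puts \<open>v\<close> inside and, since
  \<open>g s = 0\<close> is the minimum, keeps out the sink, where no flux inequality is
  assumed.\<close>

lemma subsolution_edge_drop:
  assumes g: "subsolution g" and v: "v \<in> verts G" and w: "w \<in> nbrs v"
  shows "g v - g w \<le> d * n"
proof (cases "g w < g v")
  case True
  define S where "S = {x \<in> verts G. g w < g x}"
  have S: "S \<subseteq> verts G - {s}" "v \<in> S" "finite S"
    using g v True subsetD[OF nbrs_subset w] by (auto simp: S_def subsolution_def)
  have nonneg: "0 \<le> g x - g y" if "x \<in> S" "y \<in> nbrs x - S" for x y
    using that nbrs_subset[of x] by (auto simp: S_def not_less intro: less_imp_le order_trans)
  have "g v - g w \<le> (\<Sum>y\<in>nbrs v - S. g v - g y)"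
    using w nonneg[OF \<open>v \<in> S\<close>] by (intro member_le_sum) (auto simp: S_def)
  also have "\<dots> \<le> (\<Sum>x\<in>S. \<Sum>y\<in>nbrs x - S. g x - g y)"
    using S nonneg by (intro member_le_sum[of v S "\<lambda>x. \<Sum>y\<in>nbrs x - S. g x - g y"] sum_nonneg) auto
  also have "\<dots> = (\<Sum>x\<in>S. \<Sum>y\<in>nbrs x. g x - g y)"
    using S by (intro flux_eq_boundary_flux[symmetric]) auto
  also have "\<dots> \<le> (\<Sum>x\<in>S. real d)"
    using g S by (intro sum_mono) (auto simp: subsolution_def)
  also have "\<dots> = real (d * card S)"
    by simp
  also have "\<dots> \<le> real (d * n)"
    using S by (intro of_nat_mono mult_left_mono card_mono) auto
  finally show ?thesis .
next
  case False
  moreover have "0 \<le> real (d * n)"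
    by simp
  ultimately show ?thesis
    by linarith
qed

lemma sublevel_growth:
  assumes g: "subsolution g" and v: "v \<in> verts G" and gv: "real (3 * d * n * j) < g v"
  shows "d * j \<le> card {x \<in> verts G. g x \<le> real (3 * d * n * j)}"
  using gv
proof (induction j)
  case (Suc j)
  define D where "D = real d * n"
  define t where "t = real (3 * d * n * j)"
  have D: "0 \<le> D"
    by (simp add: D_def)
  have t: "0 \<le> t" and tS: "real (3 * d * n * Suc j) = t + 3 * D"
    by (auto simp: t_def D_def algebra_simps)
  have gv: "t + 3 * D < g v"
    using Suc.prems by (simp only: tS)
  let ?L = "\<lambda>r. {x \<in> verts G. g x \<le> r}"
  \<comment> \<open>The cut is made at \<open>t + D\<close>: just across it, \<open>y\<close> has
    level in \<open>(t + D, t + 2 * D]\<close>, so its neighbours, one edge further, stay in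
    \<open>(t, t + 3 * D]\<close>. They are disjoint from the old sublevel set and lie in the new
    one.\<close>
  obtain x y where "x \<in> ?L (t + D)" "y \<in> verts G - ?L (t + D)" and xy: "y \<in> nbrs x"
    by (rule cut_arc[of "?L (t + D)" s v])
      (use g v sink gv t D in \<open>auto simp: subsolution_def\<close>)
  then have x: "x \<in> verts G" "g x \<le> t + D" and y: "y \<in> verts G" "t + D < g y"
    by auto
  have drop: "g a - g b \<le> D" if "b \<in> nbrs a" for a b
    using subsolution_edge_drop[OF g _ that] that nbrs_subset nbrs_sym[of b a] by (auto simp: D_def)
  have nb: "t < g z \<and> g z \<le> t + 3 * D" if "z \<in> nbrs y" for z
    using drop[of z y] drop[of y z] drop[of x y] that xy x y by (auto simp: nbrs_sym)
  have "d * j \<le> card (?L t)"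
    using Suc.IH gv D by (simp only: t_def)
  then have "d * Suc j \<le> card (?L t) + card (nbrs y)"
    by (simp add: card_nbrs[OF y(1)])
  also have "\<dots> = card (?L t \<union> nbrs y)"
    using nb by (subst card_Un_disjoint) fastforce+
  also have "\<dots> \<le> card (?L (t + 3 * D))"
    using nb D nbrs_subset[of y] by (intro card_mono) auto
  finally show ?case
    by (simp only: tS)
qed auto

lemma d_le_n: "d \<le> n"
  using card_mono[OF _ nbrs_subset] card_nbrs sink by fastforce

lemma subsolution_le:
  assumes "subsolution g" "v \<in> verts G"
  shows "g v \<le> 6 * real n ^ 2"
proof -
  \<comment> \<open>The smallest \<open>j\<close> with \<open>n < d * j\<close>: a value above level
    \<open>3 * d * n * j\<close> would force more than \<open>n\<close> vertices below that level.
    Rounding up costs at most \<open>d\<close>, and \<open>d \<le> n\<close> then gives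
    \<open>d * j \<le> 2 * n\<close>.\<close>
  define j where "j = n div d + 1"
  have "n < d * j"
    using d_pos by (simp add: j_def dividend_less_times_div)
  moreover have "card {x \<in> verts G. g x \<le> real (3 * d * n * j)} \<le> n"
    by (intro card_mono) auto
  ultimately have "g v \<le> real (3 * d * n * j)"
    using sublevel_growth[OF assms, of j] by linarith
  also have "3 * d * n * j \<le> 6 * n ^ 2"
  proof -
    have "d * j \<le> n + n"
      using d_le_n by (simp add: j_def add_mono)
    from mult_left_mono[OF this, of "3 * n"] show ?thesis
      by (simp add: power2_eq_square algebra_simps)
  qed
  then have "real (3 * d * n * j) \<le> 6 * real n ^ 2"
    by (metis of_nat_mono of_nat_mult of_nat_numeral of_nat_power)
  finally show ?thesis .
qed

section \<open>Hitting times as limits of truncated ones\<close>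

text \<open>The expected time to hit the sink, truncated at \<open>k\<close>.\<close>

primrec hit :: "nat \<Rightarrow> 'a \<Rightarrow> real" where
  "hit 0 = (\<lambda>v. 0)"
| "hit (Suc k) = (\<lambda>v. if v = s then 0 else 1 + (\<Sum>w\<in>nbrs v. hit k w) / d)"

lemma hit_sink [simp]: "hit k s = 0"
  by (cases k) auto

lemma hit_nonneg: "0 \<le> hit k v"
  by (induction k arbitrary: v) (auto intro!: add_nonneg_nonneg divide_nonneg_nonneg sum_nonneg)

lemma hit_le_Suc: "hit k v \<le> hit (Suc k) v"
proof (induction k arbitrary: v)
  case 0
  show ?case
    using hit_nonneg[of 1 v] by simp
next
  case (Suc k)
  have "(\<Sum>w\<in>nbrs v. hit k w) / d \<le> (\<Sum>w\<in>nbrs v. hit (Suc k) w) / d"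
    by (intro divide_right_mono sum_mono Suc.IH) simp
  then show ?case
    by simp
qed

text \<open>\<open>hit (Suc k)\<close> satisfies the hitting time equation with \<open>hit k\<close>
  on the right, and monotonicity in \<open>k\<close> turns this into an inequality for
  \<open>hit k\<close> alone. The one-sided form of \<open>subsolution\<close> thus makes the
  quadratic bound available uniformly in \<open>k\<close>, before any limit is known to
  exist.\<close>

lemma subsolution_hit: "subsolution (hit k)"
proof -
  have "(\<Sum>w\<in>nbrs v. hit k v - hit k w) \<le> d" if v: "v \<in> verts G - {s}" for v
  proof -
    have "(\<Sum>w\<in>nbrs v. hit k v - hit k w) = d * hit k v - (\<Sum>w\<in>nbrs v. hit k w)"
      using v by (simp add: sum_subtractf card_nbrs)
    also have "\<dots> \<le> d * hit (Suc k) v - (\<Sum>w\<in>nbrs v. hit k w)"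
      using hit_le_Suc by (simp add: mult_left_mono del: hit.simps)
    also have "\<dots> = d"
      using v d_pos by (simp add: field_simps)
    finally show ?thesis .
  qed
  then show ?thesis
    by (simp add: subsolution_def hit_nonneg)
qed

text \<open>Monotone convergence under the uniform bound gives the limit; passing to it in the
  recursion of \<open>hit\<close> gives the exact equation.\<close>

lemma hitting_time:
  obtains h :: "'a \<Rightarrow> real" where "h s = 0"
    and "\<And>v. v \<in> verts G \<Longrightarrow> 0 \<le> h v"
    and "\<And>v. v \<in> verts G \<Longrightarrow> h v \<le> 6 * real n ^ 2"
    and "\<And>v. v \<in> verts G - {s} \<Longrightarrow> d * h v = d + (\<Sum>w\<in>nbrs v. h w)"
proof -
  have "\<exists>l. (\<lambda>k. hit k v) \<longlonglongrightarrow> l" if v: "v \<in> verts G" for v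
    by (rule incseq_convergent[of "\<lambda>k. hit k v" "6 * real n ^ 2"])
      (use hit_le_Suc subsolution_le[OF subsolution_hit v] in \<open>auto intro!: incseq_SucI simp del: hit.simps\<close>)
  then obtain h where h: "\<And>v. v \<in> verts G \<Longrightarrow> (\<lambda>k. hit k v) \<longlonglongrightarrow> h v"
    by metis
  show thesis
  proof
    show "h s = 0"
      using LIMSEQ_unique[OF h[OF sink], of 0] by simp
    show "0 \<le> h v" if "v \<in> verts G" for v
      using h[OF that] by (rule LIMSEQ_le_const) (auto simp: hit_nonneg)
    show "h v \<le> 6 * real n ^ 2" if "v \<in> verts G" for v
      using h[OF that] by (rule LIMSEQ_le_const2) (use subsolution_le[OF subsolution_hit that] in auto)
    show "d * h v = d + (\<Sum>w\<in>nbrs v. h w)" if v: "v \<in> verts G - {s}" for v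
    proof -
      have "(\<lambda>k. hit (Suc k) v) \<longlonglongrightarrow> h v"
        using h v by (intro LIMSEQ_Suc) auto
      moreover have "(\<lambda>k. hit (Suc k) v) \<longlonglongrightarrow> 1 + (\<Sum>w\<in>nbrs v. h w) / d"
        using v nbrs_subset[of v] d_pos by (auto intro!: tendsto_intros h)
      ultimately have "h v = 1 + (\<Sum>w\<in>nbrs v. h w) / d"
        by (rule LIMSEQ_unique)
      then show ?thesis
        using d_pos by (simp add: field_simps)
    qed
  qed
qed

section \<open>Decay of the potential along greedy runs\<close>

lemma greedy_step_bound:
  fixes h :: "'a \<Rightarrow> real"
  assumes step: "greedy_step G s \<sigma> \<sigma>'"
    and h: "h s = 0" "\<And>v. v \<in> verts G \<Longrightarrow> 0 \<le> h v"
      "\<And>v. v \<in> verts G \<Longrightarrow> h v \<le> 6 * real n ^ 2"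
      "\<And>v. v \<in> verts G - {s} \<Longrightarrow> d * h v = d + (\<Sum>w\<in>nbrs v. h w)"
  defines "\<Phi> \<equiv> \<lambda>\<sigma>. \<Sum>v\<in>verts G - {s}. real (\<sigma> v) * h v"
  shows "\<Phi> \<sigma>' \<le> (1 - 1 / (12 * real n ^ 3)) * \<Phi> \<sigma>" and "1 \<le> \<Phi> \<sigma>"
proof -
  let ?V = "verts G - {s}"
  obtain u where nt: "\<not> terminal G s \<sigma>" and gr: "greedy_choice G s \<sigma> u"
    and \<sigma>': "\<sigma>' = fire_times G s u (\<sigma> u div out_degree G u) \<sigma>"
    using step by (auto simp: greedy_step_def)
  define k where "k = \<sigma> u div d"
  have u: "u \<in> ?V"
    using gr by (simp add: greedy_choice_def)
  have max: "\<sigma> v div d \<le> k" if "v \<in> ?V" for v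
    using gr that u by (auto simp: greedy_choice_def k_def out_degree_eq)
  obtain v where "v \<in> ?V" "d \<le> \<sigma> v"
    using nt out_degree_eq by (auto simp: terminal_def full_def)
  then have k: "1 \<le> k"
    using max[of v] d_pos div_greater_zero_iff[of "\<sigma> v" d] by linarith
  \<comment> \<open>Maximality keeps every count below \<open>d * k + d\<close>, and
    \<open>1 \<le> k\<close> absorbs the remainder.\<close>
  have chips: "real (\<sigma> v) \<le> 2 * k * d" if "v \<in> ?V" for v
  proof -
    have "\<sigma> v < d * (\<sigma> v div d) + d"
      using d_pos dividend_less_times_div[of d "\<sigma> v"] by simp
    also have "\<dots> \<le> d * k + d * k"
      using max[OF that] k by (intro add_mono mult_left_mono) auto
    finally have "\<sigma> v \<le> 2 * k * d"
      by (simp add: mult.commute)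
    then show ?thesis
      by (metis of_nat_le_iff of_nat_mult of_nat_numeral)
  qed
  have "k * d \<le> \<sigma> u"
    by (simp add: k_def)
  then have \<sigma>'_eq: "real (\<sigma>' v) = \<sigma> v - (if v = u then real k * d else 0) +
      (if v \<in> nbrs u then real k else 0)" if "v \<in> ?V" for v
    using that u by (auto simp: \<sigma>' fire_times_def out_degree_eq nbrs_def of_nat_diff
        simp flip: k_def dest: adj_not_same)
  have "\<Phi> \<sigma>' = \<Phi> \<sigma> - (\<Sum>v\<in>?V. if v = u then k * d * h v else 0) +
      (\<Sum>v\<in>?V. if v \<in> nbrs u then k * h v else 0)"
    unfolding \<Phi>_def sum_subtractf[symmetric] sum.distrib[symmetric]
    by (intro sum.cong) (auto simp: \<sigma>'_eq algebra_simps)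
  also have "(\<Sum>v\<in>?V. if v = u then k * d * h v else 0) = k * d * h u"
    using u by (simp add: sum.delta)
  \<comment> \<open>The sink may join the sum because \<open>h s = 0\<close>: chips discarded there
    carry no potential.\<close>
  also have "(\<Sum>v\<in>?V. if v \<in> nbrs u then k * h v else 0) = (\<Sum>v\<in>nbrs u. k * h v)"
    using h(1) nbrs_subset by (intro sum.mono_neutral_cong) auto
  also have "\<dots> = k * (d * h u - d)"
    using h(4)[OF u] by (simp flip: sum_distrib_left)
  finally have drop: "\<Phi> \<sigma>' = \<Phi> \<sigma> - k * d"
    by (simp add: algebra_simps)
  have "\<Phi> \<sigma> \<le> (\<Sum>v\<in>?V. 2 * k * d * (6 * real n ^ 2))"
    unfolding \<Phi>_def using chips h by (intro sum_mono mult_mono) auto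
  also have "\<dots> = card ?V * (2 * k * d * (6 * real n ^ 2))"
    by simp
  also have "\<dots> \<le> n * (2 * k * d * (6 * real n ^ 2))"
    by (intro mult_right_mono) (auto intro!: card_mono)
  also have "\<dots> = 12 * real n ^ 3 * (k * d)"
    by (simp add: power2_eq_square power3_eq_cube)
  finally have "\<Phi> \<sigma> / (12 * real n ^ 3) \<le> k * d"
    using n_pos by (simp add: divide_le_eq mult.commute)
  then show "\<Phi> \<sigma>' \<le> (1 - 1 / (12 * real n ^ 3)) * \<Phi> \<sigma>"
    using drop by (simp add: algebra_simps)
  \<comment> \<open>The drop \<open>k * d\<close> is at least 1 and leaves the potential
    nonnegative.\<close>
  have "0 \<le> \<Phi> \<sigma>'"
    unfolding \<Phi>_def using h by (intro sum_nonneg) auto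
  moreover have "1 \<le> real k * d"
    using k d_pos mult_le_mono[of 1 k 1 d] by (simp flip: of_nat_mult)
  ultimately show "1 \<le> \<Phi> \<sigma>"
    using drop by simp
qed

text \<open>Before the last of the \<open>Suc T\<close> iterations the potential is still at least
  1, while \<open>T\<close> contractions have brought it down to at most
  \<open>exp (- T / (12 * n ^ 3))\<close> times its initial value.\<close>

lemma greedy_run_bound:
  assumes run: "(greedy_step G s ^^ Suc T) \<sigma> \<tau>"
  shows "real T \<le> 12 * real n ^ 3 * ln (6 * real n ^ 2 * nonsink_chips G s \<sigma>)"
proof -
  obtain h :: "'a \<Rightarrow> real" where h: "h s = 0" "\<And>v. v \<in> verts G \<Longrightarrow> 0 \<le> h v"
      "\<And>v. v \<in> verts G \<Longrightarrow> h v \<le> 6 * real n ^ 2"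
      "\<And>v. v \<in> verts G - {s} \<Longrightarrow> d * h v = d + (\<Sum>w\<in>nbrs v. h w)"
    by (rule hitting_time) (rule that)
  define \<Phi> where "\<Phi> \<rho> = (\<Sum>v\<in>verts G - {s}. real (\<rho> v) * h v)" for \<rho> :: "'a \<Rightarrow> nat"
  note step = greedy_step_bound[OF _ h, folded \<Phi>_def]
  define q where "q = 1 / (12 * real n ^ 3)"
  have "1 \<le> real n ^ 3"
    using n_pos by (intro one_le_power) linarith
  then have "1 \<le> 12 * real n ^ 3"
    by linarith
  then have q: "0 < q" "q \<le> 1"
    using n_pos by (simp_all add: q_def)
  have decay: "\<Phi> \<rho> \<le> (1 - q) ^ t * \<Phi> \<sigma>" if "(greedy_step G s ^^ t) \<sigma> \<rho>" for t \<rho>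
    using that
  proof (induction t arbitrary: \<rho>)
    case (Suc t)
    then obtain \<rho>' where \<rho>': "(greedy_step G s ^^ t) \<sigma> \<rho>'" "greedy_step G s \<rho>' \<rho>"
      by auto
    have "\<Phi> \<rho> \<le> (1 - q) * \<Phi> \<rho>'"
      using step(1)[OF \<rho>'(2)] by (simp add: q_def)
    also have "\<dots> \<le> (1 - q) * ((1 - q) ^ t * \<Phi> \<sigma>)"
      using q Suc.IH[OF \<rho>'(1)] by (intro mult_left_mono) auto
    finally show ?case
      by simp
  qed auto
  obtain \<rho> where \<rho>: "(greedy_step G s ^^ T) \<sigma> \<rho>" "greedy_step G s \<rho> \<tau>"
    using run by auto
  have "\<Phi> \<sigma> \<le> (\<Sum>v\<in>verts G - {s}. real (\<sigma> v) * (6 * real n ^ 2))"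
    unfolding \<Phi>_def using h by (intro sum_mono mult_left_mono) auto
  also have "\<dots> = 6 * real n ^ 2 * nonsink_chips G s \<sigma>"
    by (simp add: nonsink_chips_def mult.commute flip: sum_distrib_right)
  finally have \<Phi>\<sigma>: "\<Phi> \<sigma> \<le> 6 * real n ^ 2 * nonsink_chips G s \<sigma>" .
  have "1 \<le> (1 - q) ^ T * \<Phi> \<sigma>"
    using step(2)[OF \<rho>(2)] decay[OF \<rho>(1)] by linarith
  also have "\<dots> \<le> exp (- q) ^ T * (6 * real n ^ 2 * nonsink_chips G s \<sigma>)"
  proof (intro mult_mono power_mono \<Phi>\<sigma>)
    show "1 - q \<le> exp (- q)"
      using exp_ge_add_one_self[of "- q"] by simp
    show "0 \<le> \<Phi> \<sigma>"
      unfolding \<Phi>_def using h by (intro sum_nonneg) auto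
  qed (use q in auto)
  also have "exp (- q) ^ T = inverse (exp (T * q))"
    by (simp add: exp_minus power_inverse flip: exp_of_nat_mult)
  finally have "exp (T * q) \<le> 6 * real n ^ 2 * nonsink_chips G s \<sigma>"
    by (simp add: field_simps)
  then have "T * q \<le> ln (6 * real n ^ 2 * nonsink_chips G s \<sigma>)"
    by (smt (verit) exp_gt_zero ln_exp ln_mono)
  then show ?thesis
    using n_pos by (simp add: q_def field_simps)
qed

end

section \<open>Progress of the loop and the final constant\<close>

lemma (in graph) ex_greedy_step:
  assumes "\<not> terminal G s \<sigma>"
  shows "\<exists>\<sigma>'. greedy_step G s \<sigma> \<sigma>'"
proof -
  let ?V = "verts G - {s}" and ?f = "\<lambda>v. \<sigma> v div out_degree G v"
  have "?V \<noteq> {}"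
    using assms by (auto simp: terminal_def full_def)
  then have "Max (?f ` ?V) \<in> ?f ` ?V"
    by (intro Max_in) auto
  then obtain u where u: "u \<in> ?V" "Max (?f ` ?V) = ?f u"
    by auto
  then have "greedy_choice G s \<sigma> u"
    by (auto simp: greedy_choice_def simp flip: u(2))
  then show ?thesis
    using assms by (auto simp: greedy_step_def)
qed

text \<open>With \<open>x = n * N\<close>, the bounds \<open>6 \<le> 2 ^ 3 \<le> x ^ 3\<close> put
  the argument of the logarithm below \<open>x ^ 5\<close>, which gives the factor
  \<open>12 * 5 = 60\<close>. The remaining 1 in 61 pays for the last iteration, as
  \<open>1 \<le> n ^ 3 * ln x\<close>.\<close>

lemma ln_chips_bound:
  fixes n N T :: nat
  assumes "2 \<le> n" "1 \<le> N" and T: "real T \<le> 12 * real n ^ 3 * ln (6 * real n ^ 2 * N)"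
  shows "real (Suc T) \<le> 61 * real n ^ 3 * ln (real n * N)"
proof -
  define x where "x = real n * N"
  have x: "2 \<le> x"
    using mult_mono[of 2 "real n" 1 "real N"] assms by (simp add: x_def)
  have "6 * real n ^ 2 * N \<le> 2 ^ 3 * (real n ^ 2 * real N ^ 2)"
    using assms power_increasing[of 1 2 "real N"]
      mult_mono[of 6 8 "real n ^ 2 * N" "real n ^ 2 * real N ^ 2"] by (simp add: mult.assoc)
  also have "\<dots> = 2 ^ 3 * x ^ 2"
    by (simp add: x_def power_mult_distrib)
  also have "\<dots> \<le> x ^ 3 * x ^ 2"
    using x by (intro mult_right_mono power_mono) auto
  also have "\<dots> = x ^ 5"
    by (simp flip: power_add)
  finally have "ln (6 * real n ^ 2 * N) \<le> ln (x ^ 5)"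
    using assms by (intro ln_mono) auto
  also have "\<dots> = 5 * ln x"
    using x by (simp add: ln_realpow)
  finally have "real T \<le> 12 * real n ^ 3 * (5 * ln x)"
    using T by (smt (verit) mult_left_mono zero_le_power of_nat_0_le_iff)
  \<comment> \<open>This is \<open>ln (1 / x) \<le> 1 / x - 1\<close> with
    \<open>1 / x \<le> 1 / 2\<close>.\<close>
  moreover have "1 / 2 \<le> ln x"
    using ln_le_minus_one[of "inverse x"] le_imp_inverse_le[OF x] x by (simp add: ln_inverse)
  moreover have "2 ^ 3 \<le> real n ^ 3"
    using assms by (intro power_mono) auto
  ultimately show ?thesis
    using mult_mono[of 2 "real n ^ 3" "1 / 2" "ln x"] by (simp add: x_def)
qed

theorem theorem4p5:
  shows "\<exists>C::real. C > 0 \<and>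
    (\<forall>(G :: ('a, 'b) pre_digraph) (d::nat) (n::nat) (s::'a) (\<sigma> :: 'a \<Rightarrow> nat) (N::nat).
       graph G \<and> Digraph_Component.connected G \<and> regular_graph G d \<and> card (verts G) = n \<and>
       s \<in> verts G \<and> nonsink_chips G s \<sigma> = N
       \<longrightarrow> (\<forall>(T::nat) \<tau>. (greedy_step G s ^^ T) \<sigma> \<tau> \<longrightarrow>
              real T \<le> C * real n ^ 3 * ln (real n * real N) \<and>
              (terminal G s \<tau> \<or> (\<exists>\<tau>'. greedy_step G s \<tau> \<tau>'))))"
proof (intro exI[of _ 61] conjI allI impI)
  fix G :: "('a, 'b) pre_digraph" and d n s N T and \<sigma> \<tau> :: "'a \<Rightarrow> nat"
  assume H: "graph G \<and> Digraph_Component.connected G \<and> regular_graph G d \<and> card (verts G) = n \<and>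
       s \<in> verts G \<and> nonsink_chips G s \<sigma> = N"
    and run: "(greedy_step G s ^^ T) \<sigma> \<tau>"
  interpret graph G
    using H by simp
  \<comment> \<open>A run can stop only at a terminal configuration, so the bound on run lengths is
    a bound for termination.\<close>
  show "terminal G s \<tau> \<or> (\<exists>\<tau>'. greedy_step G s \<tau> \<tau>')"
    using ex_greedy_step by blast
  show "real T \<le> 61 * real n ^ 3 * ln (real n * real N)"
  proof (cases T)
    case 0
    \<comment> \<open>The case \<open>N = 0\<close> relies on the convention
      \<open>ln 0 = 0\<close>.\<close>
    have "0 \<le> ln (real m)" for m
      by (cases m) (auto intro: ln_ge_zero)
    from this[of "n * N"] show ?thesis
      using 0 by simp
  next
    case (Suc T')
    \<comment> \<open>A first iteration needs a full vertex \<open>v\<close> other than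
      \<open>s\<close>, whence \<open>2 \<le> n\<close>. Connectivity gives \<open>v\<close> a
      neighbour, so \<open>0 < d\<close>, and the \<open>d\<close> chips on \<open>v\<close> give
      \<open>1 \<le> N\<close>.\<close>
    have "\<not> terminal G s \<sigma>"
      using relpowp_Suc_D2[of T' "greedy_step G s" \<sigma> \<tau>] run Suc by (auto simp: greedy_step_def)
    then obtain v where v: "v \<in> verts G" "v \<noteq> s" "d \<le> \<sigma> v"
      using H by (auto simp: terminal_def full_def regular_graph_def)
    have "v \<rightarrow>\<^sup>*\<^bsub>G\<^esub> s"
      using H v by (auto simp: connected_def strongly_connected_def
          reachable_mk_symmetric_eq[OF sym_arcs])
    then obtain w where "v \<rightarrow>\<^bsub>G\<^esub> w"
      using v(2) by (cases rule: converse_reachable_cases) auto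
    then have "out_arcs G v \<noteq> {}"
      by (auto simp: arcs_ends_conv out_arcs_def)
    then have "0 < card (out_arcs G v)"
      using finite_out_arcs[of v] by (simp only: card_gt_0_iff) simp
    then have "0 < d"
      using H v(1) by (auto simp: regular_graph_def out_degree_def)
    interpret regular_sink_graph G d s
      by unfold_locales (use H \<open>0 < d\<close> in auto)
    have "2 \<le> n"
      using card_mono[of "verts G" "{s, v}"] H v by auto
    moreover have "1 \<le> N"
      using H v \<open>0 < d\<close> member_le_sum[of v "verts G - {s}" \<sigma>] by (auto simp: nonsink_chips_def)
    moreover have "real T' \<le> 12 * real n ^ 3 * ln (6 * real n ^ 2 * N)"
      using greedy_run_bound run Suc H by blast
    ultimately show ?thesis
      unfolding Suc by (rule ln_chips_bound)
  qed
qed simp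

end
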